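(* Let $r\in\mathbb{Q}\setminus\{0,1,-1\}$ and let $S$ be a set of rational primes such that $|r|_p=1$ for every rational prime $p\notin S$. If $S$ is finite and $F_S$ is irrational (i.e. not a rational function), then the circle of convergence of $F_S$ is a natural boundary for the function $F_S$.
   Context: For a set $S$ of rational primes and $x\in\mathbb{Q}$, $|x|_S=\prod_{p\in S}|x|_p$ with $|\cdot|_p$ the usual $p$-adic absolute value; $|\cdot|$ is the usual real absolute value. Define $f_S(n)=|r^n-1|\cdot|r^n-1|_S$ for $n\geqslant 1$ and $F_S(z)=\sum_{n\geqslant 1}f_S(n)z^n$. The circle of convergence of a power series is a natural boundary if the series has no analytic continuation to any connected open set properly containing its open disc of convergence (equivalently, every point of the circle is a singularity). *)

theory Defs
  imports "HOL-Complex_Analysis.Complex_Analysis"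
begin

definition padic_abs :: "nat \<Rightarrow> rat \<Rightarrow> real" where
  "padic_abs p x =
     (if x = 0 then 0
      else (let (a, b) = quotient_of x
            in real p powi (int (multiplicity (int p) b) - int (multiplicity (int p) a))))"

(* For infinite S the library product is 1 by convention, so this is only meant for finite S. *)
definition S_abs :: "nat set \<Rightarrow> rat \<Rightarrow> real" where
  "S_abs S x = (\<Prod>p\<in>S. padic_abs p x)"

definition f_coeff :: "rat \<Rightarrow> nat set \<Rightarrow> nat \<Rightarrow> real" where
  "f_coeff r S n = \<bar>of_rat (r ^ n - 1)\<bar> * S_abs S (r ^ n - 1)"

definition F_series :: "rat \<Rightarrow> nat set \<Rightarrow> complex fps" where
  "F_series r S = Abs_fps (\<lambda>n. if n = 0 then 0 else of_real (f_coeff r S n))"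

definition conv_disc :: "complex fps \<Rightarrow> complex set" where
  "conv_disc F = eball 0 (fps_conv_radius F)"

(* A rational function that agrees with a holomorphic function on A has, in lowest terms,
   no poles in A; so demanding that q has no zeros in A loses no generality for such f. *)
definition rational_function_on :: "(complex \<Rightarrow> complex) \<Rightarrow> complex set \<Rightarrow> bool" where
  "rational_function_on f A \<longleftrightarrow>
     (\<exists>p q :: complex poly. \<forall>z\<in>A. poly q z \<noteq> 0 \<and> f z = poly p z / poly q z)"

(* The bounds on the radius say that there is a circle of convergence to speak of. *)
definition has_natural_boundary :: "complex fps \<Rightarrow> bool" where
  "has_natural_boundary F \<longleftrightarrow>
     0 < fps_conv_radius F \<and> fps_conv_radius F < \<infinity> \<and>
     \<not> (\<exists>U g. open U \<and> connected U \<and> conv_disc F \<subset> U \<and> g holomorphic_on U \<and>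
              (\<forall>z\<in>conv_disc F. g z = eval_fps F z))"

end

(*
  Write r = a/b in lowest terms. Up to a factor tending to 1 geometrically fast, the n-th coefficient
  is A^n c(n), where A = max(|a|, |b|) and c(n) is the product of |a^n - b^n|_q over the q in S that
  do not divide ab. If there is no such q, the series is rational. Otherwise let p be the largest one
  and w a root of unity of order p^k, k > 0. For q < p the function |a^n - b^n|_q is a uniform limit
  of periodic functions whose periods divide the numbers q^i (q - 1), hence are coprime to p. So the
  Abel means (1 - t) * sum of c(n) (t w)^n, t -> 1, only see the values of |a^n - b^n|_p, and they
  stay away from 0. Thus w/A is a singularity, and the points w are dense in the unit circle.
*)
theory Submission
  imports Defs "HOL-Library.Real_Mod" "HOL-Number_Theory.Number_Theory"
begin

subsection \<open>Divisors of differences of powers\<close>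

text \<open>The largest prime is chosen because of the factor q - 1 in the periods: for q > p it may
  be divisible by p, and then the q-adic factor could correlate with w and cancel the contribution
  of p.

  What remains is to show, for every k, that the mean at w does not vanish. No Fourier coefficient
  is computed. The order of a/b modulo p^K divides p^(K-1) (p-1), and it is unbounded in K because
  a^n = b^n only for n = 0. Hence there is a level K such that p^(k+1) divides the order modulo
  p^(K+1) but not the order modulo p^K. Cutting the p-adic absolute value off at p^(-K) gives a
  periodic sequence that w does not see, and what the cut-off changes is a sequence of one sign. The
  primes q < p enter only as a nonnegative almost periodic weight, positive for n > 0, so they
  cannot spoil the sign, and almost periodicity keeps the weight away from 0 along an arithmetic
  progression.\<close>

definition pabs :: "nat \<Rightarrow> int \<Rightarrow> real" where
  "pabs p x = (if x = 0 then 0 else 1 / real p ^ multiplicity (int p) x)"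

lemma pabs_nonneg: "0 \<le> pabs p x"
  by (simp add: pabs_def)

lemma pabs_le_1: "prime p \<Longrightarrow> pabs p x \<le> 1"
  using prime_ge_1_nat[of p] by (auto simp: pabs_def divide_le_eq)

lemma pabs_pos: "prime p \<Longrightarrow> x \<noteq> 0 \<Longrightarrow> 0 < pabs p x"
  using prime_gt_0_nat[of p] by (simp add: pabs_def)

lemma pabs_le_iff:
  assumes "prime p"
  shows "pabs p x \<le> 1 / real p ^ K \<longleftrightarrow> int p ^ K dvd x"
proof (cases "x = 0")
  case False
  have p1: "real p > 1" using prime_gt_1_nat[OF assms] by simp
  have nu: "\<not> is_unit (int p)" using prime_gt_1_nat[OF assms] by simp
  have "pabs p x \<le> 1 / real p ^ K \<longleftrightarrow> real p ^ K \<le> real p ^ multiplicity (int p) x"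
    using False p1 by (simp add: pabs_def field_simps)
  also have "\<dots> \<longleftrightarrow> K \<le> multiplicity (int p) x" using p1 by simp
  also have "\<dots> \<longleftrightarrow> int p ^ K dvd x" using power_dvd_iff_le_multiplicity[OF False nu] by simp
  finally show ?thesis .
qed (simp add: pabs_def)

text \<open>The cut-off at p^(-K) forgets everything beyond the divisibility by p^i with i at most
  K: either p^K divides both numbers and the cut-off value is attained, or both multiplicities are
  equal and below K.\<close>

lemma max_pabs_cong:
  assumes p: "prime p" and eq: "\<And>i. i \<le> K \<Longrightarrow> int p ^ i dvd x \<longleftrightarrow> int p ^ i dvd y"
  shows "max (pabs p x) (1 / real p ^ K) = max (pabs p y) (1 / real p ^ K)"
proof (cases "int p ^ K dvd x")
  case True
  then show ?thesis using eq[of K] pabs_le_iff[OF p, of _ K] by (simp add: max_def)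
next
  case False
  then have ny: "\<not> int p ^ K dvd y" using eq by simp
  define m where "m = multiplicity (int p) x"
  have x0: "x \<noteq> 0" and y0: "y \<noteq> 0" using False ny by auto
  have nu: "\<not> is_unit (int p)" using prime_gt_1_nat[OF p] by simp
  have mK: "m < K"
    using False multiplicity_dvd'[of K "int p" x] unfolding m_def by (meson not_le)
  have "multiplicity (int p) y = m"
  proof (rule multiplicity_eqI)
    show "int p ^ m dvd y" using eq[of m] mK multiplicity_dvd[of "int p" x] by (simp add: m_def)
    show "\<not> int p ^ Suc m dvd y"
      using eq[of "Suc m"] mK power_dvd_iff_le_multiplicity[OF x0 nu, of "Suc m"]
      by (simp add: m_def)
  qed
  then show ?thesis using x0 y0 by (simp add: pabs_def m_def)
qed

text \<open>Since b is a unit modulo p^K, the divisibility says that (a/b)^n = 1 there; so d is the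
  order of a/b, and Euler's theorem bounds it.\<close>

lemma power_diff_order:
  fixes a b :: int
  assumes p: "prime p" and a: "coprime a (int p)" and b: "coprime b (int p)"
  obtains d where "d dvd totient (p ^ K)" "\<And>n. int p ^ K dvd a ^ n - b ^ n \<longleftrightarrow> d dvd n"
proof -
  define N where "N = int p ^ K"
  have N0: "N > 0" using prime_gt_0_nat[OF p] by (simp add: N_def)
  have bN: "coprime b N" and aN: "coprime a N" using a b by (simp_all add: N_def)
  obtain y where y: "[b * y = 1] (mod N)" using cong_solve_coprime_int[OF bN] by auto
  \<comment> \<open>\<open>c\<close> represents a/b modulo p^K as a natural number, the form in
    which \<open>ord\<close> is applied below.\<close>
  define c where "c = nat ((a * y) mod N)"
  have ic: "int c = (a * y) mod N" using N0 by (simp add: c_def)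
  have c: "[int c = a * y] (mod N)" by (simp add: ic)
  have bc: "[b * int c = a] (mod N)"
  proof -
    have "[b * int c = b * (a * y)] (mod N)" by (rule cong_mult[OF cong_refl c])
    also have "b * (a * y) = a * (b * y)" by simp
    also have "[a * (b * y) = a * 1] (mod N)" by (rule cong_mult[OF cong_refl y])
    finally show ?thesis by simp
  qed
  have yN: "coprime y N"
    by (metis y cong_imp_coprime cong_sym coprime_1_left coprime_mult_left_iff)
  have "coprime (int c) N" 
    using aN yN c by (metis cong_imp_coprime cong_sym coprime_mult_left_iff)
  then have cc: "coprime c (p ^ K)" unfolding N_def 
    by (metis coprime_int_iff of_nat_power)
  have key: "int p ^ K dvd a ^ n - b ^ n \<longleftrightarrow> ord (p ^ K) c dvd n" for n
  proof -
    have "[a ^ n - b ^ n = (b * int c) ^ n - b ^ n] (mod N)"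
      by (intro cong_diff cong_pow cong_refl cong_sym[OF bc])
    also have "(b * int c) ^ n - b ^ n = b ^ n * (int c ^ n - 1)"
      by (simp add: power_mult_distrib algebra_simps)
    finally have "N dvd a ^ n - b ^ n \<longleftrightarrow> N dvd b ^ n * (int c ^ n - 1)"
      by (metis cong_def dvd_eq_mod_eq_0)
    also have "\<dots> \<longleftrightarrow> N dvd int c ^ n - 1"
      using bN by (intro coprime_dvd_mult_right_iff) (simp add: coprime_commute)
    also have "\<dots> \<longleftrightarrow> [int c ^ n = 1] (mod N)" by (simp add: cong_iff_dvd_diff)
    also have "\<dots> \<longleftrightarrow> [c ^ n = 1] (mod p ^ K)"
      unfolding N_def by (metis cong_int_iff of_nat_1 of_nat_power)
    also have "\<dots> \<longleftrightarrow> ord (p ^ K) c dvd n" by (rule ord_divides)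
    finally show ?thesis by (simp add: N_def)
  qed
  have "ord (p ^ K) c dvd totient (p ^ K)"
    using euler_theorem[OF cc] ord_divides by blast
  then show ?thesis using key that by blast
qed

text \<open>Modulo p^K the powers a^d and b^d agree, so a shift of n by d multiplies a^n - b^n by
  the unit a^d. After the cut-off this approximate period is an exact one.\<close>

lemma max_pabs_power_diff_periodic:
  fixes a b :: int
  assumes p: "prime p" and a: "coprime a (int p)" and d: "int p ^ K dvd a ^ d - b ^ d"
  shows "max (pabs p (a ^ (n + d) - b ^ (n + d))) (1 / real p ^ K)
       = max (pabs p (a ^ n - b ^ n)) (1 / real p ^ K)"
proof (rule max_pabs_cong[OF p])
  fix i assume "i \<le> K"
  then have di: "int p ^ i dvd a ^ d - b ^ d" using d by (meson dvd_trans le_imp_power_dvd)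
  have "a ^ (n + d) - b ^ (n + d) = a ^ d * (a ^ n - b ^ n) + b ^ n * (a ^ d - b ^ d)"
    by (simp add: power_add algebra_simps)
  then have "int p ^ i dvd a ^ (n + d) - b ^ (n + d) \<longleftrightarrow> int p ^ i dvd a ^ d * (a ^ n - b ^ n)"
    using di by (simp add: dvd_add_left_iff)
  also have "\<dots> \<longleftrightarrow> int p ^ i dvd a ^ n - b ^ n"
    using a by (intro coprime_dvd_mult_right_iff) (simp add: coprime_commute)
  finally show "int p ^ i dvd a ^ (n + d) - b ^ (n + d) \<longleftrightarrow> int p ^ i dvd a ^ n - b ^ n" .
qed

text \<open>The part of d prime to p divides p - 1. If the p-part of d were at most p^k, all of d
  would divide p^k (p-1).\<close>

lemma prime_power_order_dvd:
  assumes p: "prime (p::nat)" and d: "d dvd totient (p ^ K)" and n: "\<not> d dvd p ^ k * (p - 1)"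
  shows "p ^ Suc k dvd d"
proof (rule ccontr)
  assume nd: "\<not> p ^ Suc k dvd d"
  have K: "K > 0"
    using d n by (cases K) auto
  have d': "d dvd p ^ (K - 1) * (p - 1)"
    using d K p by (simp add: totient_power totient_prime)
  have "d \<noteq> 0" using nd by (metis dvd_0_right)
  then obtain m where m: "d = p ^ multiplicity p d * m" "\<not> p dvd m"
    using p multiplicity_decompose'[of d p] by (metis not_prime_unit)
  have "multiplicity p d \<le> k"
    using nd \<open>d \<noteq> 0\<close> p multiplicity_dvd'[of "Suc k" p d] by (meson not_less_eq_eq)
  then have 1: "p ^ multiplicity p d dvd p ^ k" by (rule le_imp_power_dvd)
  have "coprime m (p ^ (K - 1))"
    using p m(2) by (metis coprime_commute coprime_power_right_iff prime_imp_coprime)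
  moreover have "m dvd p ^ (K - 1) * (p - 1)" using d' m(1) by (metis dvd_mult_right)
  ultimately have "m dvd p - 1" by (simp add: coprime_dvd_mult_right_iff)
  with 1 have "d dvd p ^ k * (p - 1)" by (subst m(1)) (rule mult_dvd_mono)
  with n show False by simp
qed

text \<open>Let d_K be the order of a/b modulo p^K. It is 1 for K = 0, and p^(k+1) divides it for
  large K; so there are two consecutive levels between which this divisibility sets in. A root of
  unity of order p^(k+1) is invisible at the lower level and resonates at the upper one.\<close>

lemma power_diff_order_jump:
  fixes a b :: int
  assumes p: "prime p" and a: "coprime a (int p)" and b: "coprime b (int p)"
    and neq: "\<And>n. n > 0 \<Longrightarrow> a ^ n \<noteq> b ^ n"
  obtains K d e where "d > 0" "\<not> p ^ Suc k dvd d" "int p ^ K dvd a ^ d - b ^ d"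
    "p ^ Suc k dvd e" "e > 0" "\<And>n. int p ^ Suc K dvd a ^ n - b ^ n \<longleftrightarrow> e dvd n"
proof -
  have "\<forall>K. \<exists>d. d dvd totient (p ^ K) \<and> (\<forall>n. int p ^ K dvd a ^ n - b ^ n \<longleftrightarrow> d dvd n)"
    using power_diff_order[OF p a b] by metis
  then obtain d where d: "\<And>K. d K dvd totient (p ^ K)"
    and dn: "\<And>K n. int p ^ K dvd a ^ n - b ^ n \<longleftrightarrow> d K dvd n"
    by metis
  have dpos: "d K > 0" for K
    using d[of K] prime_gt_0_nat[OF p] by (intro Nat.gr0I) (use totient_0_iff[of "p ^ K"] in auto)
  have p1: "p > 1" by (rule prime_gt_1_nat[OF p])
  \<comment> \<open>The exponent is a multiple of every possible order whose p-part is at most p^k.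
    As x is nonzero, a high power of p does not divide it, so the order at that level is not of this
    kind.\<close>
  define x where "x = a ^ (p ^ k * (p - 1)) - b ^ (p ^ k * (p - 1))"
  have x0: "x \<noteq> 0" using neq[of "p ^ k * (p - 1)"] p1 by (simp add: x_def)
  define L where "L = Suc (multiplicity (int p) x)"
  have "\<not> int p ^ L dvd x"
    using power_dvd_iff_le_multiplicity[OF x0, of "int p" L] p1 by (simp add: L_def)
  then have "p ^ Suc k dvd d L"
    using prime_power_order_dvd[OF p d] dn unfolding x_def by blast
  moreover have "\<not> p ^ Suc k dvd d 0"
  proof -
    have "d 0 dvd 1" using dn[of 0 1] by simp
    then show ?thesis using p1 by (auto simp: nat_dvd_1_iff_1)
  qed
  ultimately obtain K where "\<not> p ^ Suc k dvd d K" "p ^ Suc k dvd d (Suc K)"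
    using dec_induct[of 0 L "\<lambda>K. \<not> p ^ Suc k dvd d K"] by auto
  then show ?thesis using that[OF dpos _ _ _ dpos dn] dn[of K "d K"] by simp
qed

subsection \<open>Abel means of almost periodic sequences\<close>

text \<open>The Abel version of the average of u(n) w^n, that is, of a Fourier coefficient of u. It
  agrees with the limit of the ordinary averages whenever that limit exists.\<close>

definition abel_mean :: "(nat \<Rightarrow> real) \<Rightarrow> complex \<Rightarrow> real \<Rightarrow> complex" where
  "abel_mean u w \<rho> = of_real (1 - \<rho>) * (\<Sum>n. of_real (u n) * (of_real \<rho> * w) ^ n)"

lemma norm_summable_bounded:
  fixes w :: complex
  assumes B: "\<And>n. \<bar>u n\<bar> \<le> B" and w: "norm w = 1" and \<rho>: "0 \<le> \<rho>" "\<rho> < 1"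
  shows "summable (\<lambda>n. norm (of_real (u n) * (of_real \<rho> * w) ^ n :: complex))"
proof (rule summable_comparison_test')
  show "summable (\<lambda>n. B * \<rho> ^ n)" using \<rho> by (intro summable_mult summable_geometric) auto
  show "norm (norm (of_real (u n) * (of_real \<rho> * w) ^ n :: complex)) \<le> B * \<rho> ^ n" for n
    using B[of n] \<rho> w by (simp add: norm_mult norm_power mult_right_mono)
qed

lemma summable_bounded:
  fixes w :: complex
  assumes "\<And>n. \<bar>u n\<bar> \<le> B" "norm w = 1" "0 \<le> \<rho>" "\<rho> < 1"
  shows "summable (\<lambda>n. of_real (u n) * (of_real \<rho> * w) ^ n :: complex)"
  using norm_summable_bounded[OF assms] by (rule summable_norm_cancel)

text \<open>The factor 1 - \<rho> cancels the sum of the geometric series, so the bound is uniform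
  in \<rho>. This is what carries uniform approximations of u through the limit.\<close>

lemma norm_abel_mean_le:
  assumes B: "\<And>n. \<bar>u n\<bar> \<le> B" and w: "norm w = 1" and \<rho>: "0 \<le> \<rho>" "\<rho> < 1"
  shows "norm (abel_mean u w \<rho>) \<le> B"
proof -
  have "norm (\<Sum>n. of_real (u n) * (of_real \<rho> * w) ^ n) \<le> (\<Sum>n. B * \<rho> ^ n)"
    using B \<rho> w
    by (intro norm_suminf_le summable_mult summable_geometric)
       (auto simp: norm_mult norm_power mult_right_mono)
  also have "\<dots> = B / (1 - \<rho>)"
    using \<rho> by (subst suminf_mult) (auto intro!: summable_geometric simp: suminf_geometric)
  finally have "(1 - \<rho>) * norm (\<Sum>n. of_real (u n) * (of_real \<rho> * w) ^ n) \<le> (1 - \<rho>) * (B / (1 - \<rho>))"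
    using \<rho> by (intro mult_left_mono) auto
  then show ?thesis
    using \<rho> by (simp only: abel_mean_def norm_mult norm_of_real) simp
qed

lemma abel_mean_diff:
  assumes "\<And>n. \<bar>u n\<bar> \<le> B" "\<And>n. \<bar>v n\<bar> \<le> C" and w: "norm w = 1" and \<rho>: "0 \<le> \<rho>" "\<rho> < 1"
  shows "abel_mean (\<lambda>n. u n - v n) w \<rho> = abel_mean u w \<rho> - abel_mean v w \<rho>"
proof -
  have "(\<Sum>n. of_real (u n) * (of_real \<rho> * w) ^ n) - (\<Sum>n. of_real (v n) * (of_real \<rho> * w) ^ n)
      = (\<Sum>n. of_real (u n) * (of_real \<rho> * w) ^ n - of_real (v n) * (of_real \<rho> * w) ^ n)"
    using assms by (intro suminf_diff summable_bounded)
  then show ?thesis by (simp add: abel_mean_def algebra_simps)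
qed

lemma eventually_at_left_1: "\<forall>\<^sub>F \<rho> :: real in at_left 1. 0 < \<rho> \<and> \<rho> < 1"
  using eventually_at_left_field[of _ "1::real"] zero_less_one by blast

text \<open>The power series of a sequence of period N is a polynomial divided by 1 - z^N. It has no
  pole at w, so the factor 1 - \<rho> sends the mean to 0.\<close>

lemma abel_mean_periodic_tendsto_0:
  assumes B: "\<And>n. \<bar>v n\<bar> \<le> B" and per: "\<And>n. v (n + N) = v n" and w: "norm w = 1" "w ^ N \<noteq> 1"
  shows "(abel_mean v w \<longlongrightarrow> 0) (at_left 1)"
proof -
  define P where "P z = (\<Sum>i<N. of_real (v i) * z ^ i)" for z :: complex
  have eq: "abel_mean v w \<rho> = of_real (1 - \<rho>) * (P (of_real \<rho> * w) / (1 - (of_real \<rho> * w) ^ N))"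
    if \<rho>: "0 < \<rho>" "\<rho> < 1" for \<rho>
  proof -
    define z where "z = of_real \<rho> * w"
    have "summable (\<lambda>n. of_real (v n) * z ^ n)"
      unfolding z_def by (rule summable_bounded[OF B w(1)]) (use \<rho> in auto)
    note split = suminf_split_initial_segment[OF this, of N]
    have "(\<Sum>n. of_real (v (n + N)) * z ^ (n + N)) = (\<Sum>n. z ^ N * (of_real (v n) * z ^ n))"
      by (simp add: per power_add mult_ac)
    also have "\<dots> = z ^ N * (\<Sum>n. of_real (v n) * z ^ n)"
      by (rule suminf_mult) fact
    finally have "(\<Sum>n. of_real (v n) * z ^ n) * (1 - z ^ N) = P z"
      using split by (simp add: P_def algebra_simps)
    moreover have "z ^ N \<noteq> 1"
    proof
      assume "z ^ N = 1"
      then have "norm z ^ N = 1" by (metis norm_one norm_power)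
      then have "\<rho> ^ N = 1" using \<rho> w by (simp add: z_def norm_mult)
      moreover have "N \<noteq> 0" using w by (intro notI) simp
      ultimately show False using \<rho> by (metis less_irrefl less_le power_eq_1_iff norm_ge_zero abs_of_pos real_norm_def)
    qed
    ultimately have "(\<Sum>n. of_real (v n) * z ^ n) = P z / (1 - z ^ N)"
      by (simp add: eq_divide_eq)
    then show ?thesis by (simp add: abel_mean_def flip: z_def)
  qed
  have "((\<lambda>\<rho>. of_real (1 - \<rho>) * (P (of_real \<rho> * w) / (1 - (of_real \<rho> * w) ^ N))) \<longlongrightarrow>
     of_real (1 - 1) * (P (of_real 1 * w) / (1 - (of_real 1 * w) ^ N))) (at_left 1)"
    unfolding P_def using w by (intro tendsto_intros) auto
  moreover have "\<forall>\<^sub>F \<rho> in at_left 1. of_real (1 - \<rho>) * (P (of_real \<rho> * w) / (1 - (of_real \<rho> * w) ^ N))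
      = abel_mean v w \<rho>"
    using eventually_at_left_1 by eventually_elim (simp add: eq)
  ultimately show ?thesis by (simp add: tendsto_cong)
qed

lemma abel_mean_almost_periodic_tendsto_0:
  assumes B: "\<And>n. \<bar>u n\<bar> \<le> B" and w: "norm w = 1"
    and approx: "\<And>\<epsilon>. \<epsilon> > 0 \<Longrightarrow> \<exists>N v. w ^ N \<noteq> 1 \<and> (\<forall>n. v (n + N) = v n) \<and> (\<forall>n. \<bar>u n - v n\<bar> \<le> \<epsilon>)"
  shows "(abel_mean u w \<longlongrightarrow> 0) (at_left 1)"
proof (rule tendstoI)
  fix \<epsilon> :: real assume "\<epsilon> > 0"
  then obtain N v where N: "w ^ N \<noteq> 1" and v: "\<And>n. v (n + N) = v n" "\<And>n. \<bar>u n - v n\<bar> \<le> \<epsilon> / 2"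
    using approx[of "\<epsilon> / 2"] by auto
  have vB: "\<bar>v n\<bar> \<le> B + \<epsilon> / 2" for n using B[of n] v(2)[of n] by linarith
  have "\<forall>\<^sub>F \<rho> in at_left 1. dist (abel_mean v w \<rho>) 0 < \<epsilon> / 2"
    using abel_mean_periodic_tendsto_0[where v = v, OF vB v(1) w N] \<open>\<epsilon> > 0\<close> by (intro tendstoD) auto
  with eventually_at_left_1 show "\<forall>\<^sub>F \<rho> in at_left 1. dist (abel_mean u w \<rho>) 0 < \<epsilon>"
  proof eventually_elim
    case (elim \<rho>)
    have "norm (abel_mean (\<lambda>n. u n - v n) w \<rho>) \<le> \<epsilon> / 2"
      using elim by (intro norm_abel_mean_le v w) auto
    moreover have "abel_mean (\<lambda>n. u n - v n) w \<rho> = abel_mean u w \<rho> - abel_mean v w \<rho>"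
      by (rule abel_mean_diff[OF B vB w]) (use elim in auto)
    ultimately show ?case
      using elim norm_triangle_sub[of "abel_mean u w \<rho>" "abel_mean v w \<rho>"] by simp
  qed
qed

lemma abel_mean_summable_tendsto_0:
  assumes u: "summable (\<lambda>n. \<bar>u n\<bar>)" and w: "norm w = 1"
  shows "(abel_mean u w \<longlongrightarrow> 0) (at_left 1)"
proof (rule Lim_null_comparison)
  show "\<forall>\<^sub>F \<rho> in at_left 1. norm (abel_mean u w \<rho>) \<le> (1 - \<rho>) * (\<Sum>n. \<bar>u n\<bar>)"
    using eventually_at_left_1
  proof eventually_elim
    case (elim \<rho>)
    have "norm (of_real (u n) * (of_real \<rho> * w) ^ n) \<le> \<bar>u n\<bar>" for n
      using elim w by (simp add: norm_mult norm_power mult_left_le power_le_one)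
    then have "norm (\<Sum>n. of_real (u n) * (of_real \<rho> * w) ^ n) \<le> (\<Sum>n. \<bar>u n\<bar>)"
      by (intro norm_suminf_le u)
    then show ?case using elim 
      by (simp only: abel_mean_def norm_mult norm_of_real) (simp add: mult_left_mono)
  qed
  have "((\<lambda>\<rho>. (1 - \<rho>) * (\<Sum>n. \<bar>u n\<bar>)) \<longlongrightarrow> (1 - 1) * (\<Sum>n. \<bar>u n\<bar>)) (at_left 1)"
    by (intro tendsto_intros)
  then show "((\<lambda>\<rho>. (1 - \<rho>) * (\<Sum>n. \<bar>u n\<bar>)) \<longlongrightarrow> 0) (at_left 1)" by simp
qed

text \<open>On the support of \<open>D\<close> the powers of w are 1, so the mean is a sum of
  nonnegative reals without cancellation. Its part on the progression m + t M, of density 1/M,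
  already keeps it near or above c/M.\<close>

lemma abel_mean_not_tendsto_0:
  assumes D: "\<And>n. 0 \<le> D n" "\<And>n. D n \<le> B" and w: "norm w = 1" and supp: "\<And>n. D n \<noteq> 0 \<Longrightarrow> w ^ n = 1"
    and c: "c > 0" and M: "M > 0" and low: "\<And>t. c \<le> D (m + t * M)"
  shows "\<not> (abel_mean D w \<longlongrightarrow> 0) (at_left 1)"
proof
  assume lim: "(abel_mean D w \<longlongrightarrow> 0) (at_left 1)"
  have D': "\<bar>D n\<bar> \<le> B" for n using D[of n] by simp
  have low': "c * \<rho> ^ m / real M \<le> norm (abel_mean D w \<rho>)" if \<rho>: "0 < \<rho>" "\<rho> < 1" for \<rho>
  proof -
    have term_eq: "of_real (D n) * (of_real \<rho> * w) ^ n = of_real (D n * \<rho> ^ n)" for n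
      using supp[of n] by (cases "D n = 0") (auto simp: power_mult_distrib)
    have sm: "summable (\<lambda>n. D n * \<rho> ^ n)"
      using norm_summable_bounded[OF D' w, of \<rho>] \<rho> D by (simp add: norm_mult norm_power w)
    have inj: "inj (\<lambda>t. m + t * M)" using M by (auto intro: injI)
    have rM: "\<rho> ^ M < 1" using \<rho> M by (simp add: power_less_one_iff)
    have gs: "(\<lambda>t. c * \<rho> ^ m * (\<rho> ^ M) ^ t) sums (c * \<rho> ^ m * (1 / (1 - \<rho> ^ M)))"
      using \<rho> rM by (intro sums_mult geometric_sums) auto
    have "c * \<rho> ^ m * (1 / (1 - \<rho> ^ M)) = (\<Sum>t. c * \<rho> ^ m * (\<rho> ^ M) ^ t)"
      using gs by (simp add: sums_iff)
    also have "\<dots> \<le> (\<Sum>t. ((\<lambda>n. D n * \<rho> ^ n) \<circ> (\<lambda>t. m + t * M)) t)"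
    proof (rule suminf_le)
      show "c * \<rho> ^ m * (\<rho> ^ M) ^ t \<le> ((\<lambda>n. D n * \<rho> ^ n) \<circ> (\<lambda>t. m + t * M)) t" for t
        using mult_right_mono[OF low[of t], of "\<rho> ^ (m + t * M)"] \<rho>
        by (simp add: power_add mult.commute[of t M] power_mult mult_ac)
      show "summable (\<lambda>t. c * \<rho> ^ m * (\<rho> ^ M) ^ t)" using gs by (simp add: sums_iff)
      show "summable ((\<lambda>n. D n * \<rho> ^ n) \<circ> (\<lambda>t. m + t * M))"
        using sm inj D \<rho> by (intro summable_reindex) auto
    qed
    also have "\<dots> \<le> (\<Sum>n. D n * \<rho> ^ n)"
      using sm inj D \<rho> by (intro suminf_reindex_mono) auto
    finally have 1: "c * \<rho> ^ m * (1 / (1 - \<rho> ^ M)) \<le> (\<Sum>n. D n * \<rho> ^ n)" .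
    \<comment> \<open>Bernoulli's inequality bounds (1 - \<rho>) / (1 - \<rho>^M) from below by the
      density 1/M.\<close>
    have "1 - \<rho> ^ M \<le> real M * (1 - \<rho>)"
      using Bernoulli_inequality[of "\<rho> - 1" M] \<rho> by (simp add: algebra_simps)
    then have "1 / real M \<le> (1 - \<rho>) / (1 - \<rho> ^ M)"
      using M rM by (simp add: field_simps)
    then have "c * \<rho> ^ m * (1 / real M) \<le> c * \<rho> ^ m * ((1 - \<rho>) / (1 - \<rho> ^ M))"
      using c \<rho> by (intro mult_left_mono) auto
    then have "c * \<rho> ^ m / real M \<le> (1 - \<rho>) * (c * \<rho> ^ m * (1 / (1 - \<rho> ^ M)))"
      by (simp add: mult_ac)
    also have "\<dots> \<le> (1 - \<rho>) * (\<Sum>n. D n * \<rho> ^ n)" using 1 \<rho> by (intro mult_left_mono) auto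
    also have "\<dots> \<le> norm (abel_mean D w \<rho>)"
      unfolding abel_mean_def term_eq suminf_of_real[OF sm, symmetric] by (simp only: norm_mult norm_of_real) 
        (use \<rho> in \<open>simp add: mult_left_mono\<close>)
    finally show ?thesis .
  qed
  have "((\<lambda>\<rho>. c * \<rho> ^ m / real M) \<longlongrightarrow> c * 1 ^ m / real M) (at_left 1)"
    using M by (intro tendsto_intros) auto
  moreover have "((\<lambda>\<rho>. norm (abel_mean D w \<rho>)) \<longlongrightarrow> 0) (at_left 1)"
    using lim by (rule tendsto_norm_zero)
  moreover have "\<forall>\<^sub>F \<rho> in at_left 1. c * \<rho> ^ m / real M \<le> norm (abel_mean D w \<rho>)"
    using eventually_at_left_1 by eventually_elim (simp add: low')
  ultimately have "c * 1 ^ m / real M \<le> 0"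
    by (intro tendsto_le[of "at_left 1"]) auto
  then show False using c M by (simp add: field_simps)
qed

text \<open>Uniform limits of periodic sequences whose periods are coprime to p. Their frequencies
  are roots of unity of order coprime to p, so multiplying by such a sequence cannot create or
  remove p-power divisibility of a period.\<close>

definition almost_periodic_coprime :: "nat \<Rightarrow> (nat \<Rightarrow> real) \<Rightarrow> bool" where
  "almost_periodic_coprime p g \<longleftrightarrow>
     (\<forall>\<epsilon>>0. \<exists>N>0. \<exists>v. coprime N p \<and> (\<forall>n. v (n + N) = v n) \<and> (\<forall>n. \<bar>g n - v n\<bar> \<le> \<epsilon>))"

lemma periodic_mult:
  fixes v :: "nat \<Rightarrow> 'a"
  assumes "\<And>n. v (n + N) = v n"
  shows "v (n + t * N) = v n"
proof (induction t)
  case (Suc t)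
  have "v (n + Suc t * N) = v (n + t * N + N)" by (simp add: algebra_simps)
  with Suc show ?case by (simp add: assms)
qed simp

lemma almost_periodic_coprime_mult:
  assumes g: "almost_periodic_coprime p g" "\<And>n. \<bar>g n\<bar> \<le> 1"
    and h: "almost_periodic_coprime p h" "\<And>n. \<bar>h n\<bar> \<le> 1"
  shows "almost_periodic_coprime p (\<lambda>n. g n * h n)"
  unfolding almost_periodic_coprime_def
proof (intro allI impI)
  fix \<epsilon> :: real assume "\<epsilon> > 0"
  \<comment> \<open>As e is at most 1, the approximant \<open>u\<close> is bounded by 2; the error
    of the product is then at most e + 2 e.\<close>
  define e where "e = min 1 (\<epsilon> / 3)"
  have e: "0 < e" "e \<le> 1" "3 * e \<le> \<epsilon>" using \<open>\<epsilon> > 0\<close> by (auto simp: e_def)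
  obtain N v where v: "N > 0" "coprime N p" "\<And>n. v (n + N) = v n" "\<And>n. \<bar>g n - v n\<bar> \<le> e"
    using g(1) e(1) unfolding almost_periodic_coprime_def by metis
  obtain M u where u: "M > 0" "coprime M p" "\<And>n. u (n + M) = u n" "\<And>n. \<bar>h n - u n\<bar> \<le> e"
    using h(1) e(1) unfolding almost_periodic_coprime_def by metis
  have "\<bar>g n * h n - v n * u n\<bar> \<le> \<epsilon>" for n
  proof -
    have "g n * h n - v n * u n = g n * (h n - u n) + u n * (g n - v n)" by (simp add: algebra_simps)
    then have "\<bar>g n * h n - v n * u n\<bar> \<le> \<bar>g n\<bar> * \<bar>h n - u n\<bar> + \<bar>u n\<bar> * \<bar>g n - v n\<bar>"
      by (metis abs_mult abs_triangle_ineq)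
    also have "\<dots> \<le> 1 * e + 2 * e"
      using g(2)[of n] h(2)[of n] u(4)[of n] v(4)[of n] e by (intro add_mono mult_mono) auto
    finally show ?thesis using e by simp
  qed
  moreover have "v (n + N * M) * u (n + N * M) = v n * u n" for n
    using periodic_mult[of v N n M] periodic_mult[of u M n N] v u by (simp add: mult.commute)
  ultimately show "\<exists>N>0. \<exists>v. coprime N p \<and> (\<forall>n. v (n + N) = v n) \<and> (\<forall>n. \<bar>g n * h n - v n\<bar> \<le> \<epsilon>)"
    using u v by (intro exI[of _ "N * M"] conjI exI[of _ "\<lambda>n. v n * u n"]) auto
qed

lemma almost_periodic_coprime_prod:
  assumes "finite I" "\<And>i. i \<in> I \<Longrightarrow> almost_periodic_coprime p (g i)" "\<And>i n. i \<in> I \<Longrightarrow> \<bar>g i n\<bar> \<le> 1"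
  shows "almost_periodic_coprime p (\<lambda>n. \<Prod>i\<in>I. g i n)"
  using assms
proof (induction I rule: finite_induct)
  case empty
  show ?case unfolding almost_periodic_coprime_def
    by (auto intro!: exI[of _ "1::nat"] exI[of _ "\<lambda>_. 1::real"])
next
  case (insert i I)
  have "\<bar>\<Prod>i\<in>I. g i n\<bar> \<le> 1" for n
    unfolding abs_prod using insert.prems by (intro prod_le_1) auto
  then show ?case using insert by (simp add: almost_periodic_coprime_mult)
qed

text \<open>The cut-off at q^(-K) is uniformly close to the q-adic absolute value and has period
  q^(K-1) (q-1). Here q < p is decisive: it makes q - 1 a positive number below p, hence coprime to
  p.\<close>

lemma almost_periodic_pabs_power_diff:
  fixes a b :: int
  assumes q: "prime q" and p: "prime p" and qp: "q < p"
    and a: "coprime a (int q)" and b: "coprime b (int q)"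
  shows "almost_periodic_coprime p (\<lambda>n. pabs q (a ^ n - b ^ n))"
  unfolding almost_periodic_coprime_def
proof (intro allI impI)
  fix \<epsilon> :: real assume "\<epsilon> > 0"
  have q1: "q > 1" by (rule prime_gt_1_nat[OF q])
  obtain K0 where "(1 / real q) ^ K0 < \<epsilon>"
    using real_arch_pow_inv[OF \<open>\<epsilon> > 0\<close>, of "1 / real q"] q1 by auto
  moreover have "(1 / real q) ^ Suc K0 \<le> (1 / real q) ^ K0"
    using q1 by (intro power_decreasing) auto
  ultimately have K: "1 / real q ^ Suc K0 < \<epsilon>" by (simp add: power_one_over)
  \<comment> \<open>A positive exponent, so that the totient has the form q^(K-1) (q-1).\<close>
  define K where "K = Suc K0"
  define N where "N = totient (q ^ K)"
  obtain d where "d dvd N" "\<And>n. int q ^ K dvd a ^ n - b ^ n \<longleftrightarrow> d dvd n"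
    using power_diff_order[OF q a b, of K] unfolding N_def by metis
  then have dN: "int q ^ K dvd a ^ N - b ^ N" by simp
  have N: "N = q ^ K0 * (q - 1)" using q unfolding N_def K_def by (subst totient_power_Suc) (simp add: totient_prime)
  have "coprime q p" using q p qp by (simp add: primes_coprime)
  moreover have "coprime (q - 1) p"
    using p q1 qp by (metis coprime_commute dvd_imp_le prime_imp_coprime less_imp_diff_less not_less zero_less_diff)
  ultimately have "coprime N p" by (simp add: N)
  moreover have "N > 0" using q1 by (simp add: N)
  moreover have "\<bar>pabs q x - max (pabs q x) (1 / real q ^ K)\<bar> \<le> \<epsilon>" for x
    using K pabs_nonneg[of q x] \<open>\<epsilon> > 0\<close> by (auto simp: K_def max_def)
  ultimately show "\<exists>N>0. \<exists>v. coprime N p \<and> (\<forall>n. v (n + N) = v n) \<and>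
      (\<forall>n. \<bar>pabs q (a ^ n - b ^ n) - v n\<bar> \<le> \<epsilon>)"
    using max_pabs_power_diff_periodic[OF q a dN]
    by (intro exI[of _ N] conjI exI[of _ "\<lambda>n. max (pabs q (a ^ n - b ^ n)) (1 / real q ^ K)"]) auto
qed

text \<open>\<open>g\<close> will be the product over the primes below p. It is positive only for n
  > 0 and may come arbitrarily close to 0, so the lower bound has to come from a single value of
  \<open>g\<close>, repeated approximately along a progression.\<close>

lemma abel_mean_pabs_not_tendsto_0:
  fixes a b :: int
  assumes p: "prime p" and a: "coprime a (int p)" and b: "coprime b (int p)"
    and neq: "\<And>n. n > 0 \<Longrightarrow> a ^ n \<noteq> b ^ n"
    and w: "norm w = 1" "\<And>n. w ^ n = 1 \<longleftrightarrow> p ^ Suc k dvd n"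
    and g: "almost_periodic_coprime p g" "\<And>n. 0 \<le> g n" "\<And>n. g n \<le> 1" "\<And>n. n > 0 \<Longrightarrow> 0 < g n"
  shows "\<not> (abel_mean (\<lambda>n. g n * pabs p (a ^ n - b ^ n)) w \<longlongrightarrow> 0) (at_left 1)"
proof
  assume lim: "(abel_mean (\<lambda>n. g n * pabs p (a ^ n - b ^ n)) w \<longlongrightarrow> 0) (at_left 1)"
  have p1: "real p > 1" using prime_gt_1_nat[OF p] by simp
  obtain K d e where d: "d > 0" "\<not> p ^ Suc k dvd d" "int p ^ K dvd a ^ d - b ^ d"
    and e: "p ^ Suc k dvd e" "e > 0" "\<And>n. int p ^ Suc K dvd a ^ n - b ^ n \<longleftrightarrow> e dvd n"
    using power_diff_order_jump[OF p a b neq, of k] by metis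
  define h where "h n = pabs p (a ^ n - b ^ n)" for n
  define T where "T n = max (h n) (1 / real p ^ K)" for n
  have T01: "0 \<le> T n" "T n \<le> 1" for n
    using pabs_nonneg[of p] pabs_le_1[OF p] p1 by (auto simp: T_def h_def le_max_iff_disj)
  have h01: "0 \<le> h n" "h n \<le> 1" for n using pabs_nonneg[of p] pabs_le_1[OF p] by (auto simp: h_def)
  have hT: "h n \<le> T n" for n by (simp add: T_def)
  have Tper: "T (n + d) = T n" for n
    unfolding T_def h_def by (rule max_pabs_power_diff_periodic[OF p a d(3)])
  text \<open>
    The difference \<open>T n - h n\<close> is nonnegative and supported on multiples of \<open>p ^ Suc k\<close>, where
    \<open>w ^ n = 1\<close>: it contributes to the mean without cancellation. The part with \<open>T\<close>, whose
    period \<open>d\<close> is not divisible by the order of \<open>w\<close>, contributes nothing.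
  \<close>
  define D where "D n = g n * (T n - h n)" for n
  have gT1: "\<bar>g n * T n\<bar> \<le> 1" for n
    using g(2,3)[of n] T01[of n] by (simp add: mult_le_one)
  have gh1: "\<bar>g n * h n\<bar> \<le> 1" for n
    using g(2,3)[of n] h01[of n] by (simp add: mult_le_one)
  have "(abel_mean (\<lambda>n. g n * T n) w \<longlongrightarrow> 0) (at_left 1)"
  proof (rule abel_mean_almost_periodic_tendsto_0[OF gT1 w(1)])
    fix \<epsilon> :: real assume "\<epsilon> > 0"
    then obtain N v where v: "N > 0" "coprime N p" "\<And>n. v (n + N) = v n" "\<And>n. \<bar>g n - v n\<bar> \<le> \<epsilon>"
      using g(1) unfolding almost_periodic_coprime_def by metis
    \<comment> \<open>N is coprime to p, so p^(k+1) divides the common period N d only if it divides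
      d, which it does not.\<close>
    have "coprime (p ^ Suc k) N" using v(2) by (simp add: coprime_commute)
    then have "w ^ (N * d) \<noteq> 1" using d(2) by (simp only: w(2) coprime_dvd_mult_right_iff) simp
    moreover have "v (n + N * d) * T (n + N * d) = v n * T n" for n
      using periodic_mult[of v N n d] periodic_mult[of T d n N] v(3) Tper by (simp add: mult.commute)
    moreover have "\<bar>g n * T n - v n * T n\<bar> \<le> \<epsilon>" for n
    proof -
      have "\<bar>g n * T n - v n * T n\<bar> = \<bar>g n - v n\<bar> * T n"
        using T01[of n] by (simp add: abs_mult flip: left_diff_distrib)
      also have "\<dots> \<le> \<epsilon> * 1" using v(4)[of n] T01[of n] \<open>\<epsilon> > 0\<close> by (intro mult_mono) auto
      finally show ?thesis by simp
    qed
    ultimately show "\<exists>N v. w ^ N \<noteq> 1 \<and> (\<forall>n. v (n + N) = v n) \<and> (\<forall>n. \<bar>g n * T n - v n\<bar> \<le> \<epsilon>)"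
      by (intro exI[of _ "N * d"] exI[of _ "\<lambda>n. v n * T n"]) auto
  qed
  then have "((\<lambda>\<rho>. abel_mean (\<lambda>n. g n * T n) w \<rho> - abel_mean (\<lambda>n. g n * h n) w \<rho>) \<longlongrightarrow> 0 - 0) (at_left 1)"
    using lim unfolding h_def by (rule tendsto_diff)
  moreover have "\<forall>\<^sub>F \<rho> in at_left 1. abel_mean (\<lambda>n. g n * T n) w \<rho> - abel_mean (\<lambda>n. g n * h n) w \<rho>
      = abel_mean D w \<rho>"
    using eventually_at_left_1
  proof eventually_elim
    case (elim \<rho>)
    have "D = (\<lambda>n. g n * T n - g n * h n)" by (auto simp: D_def algebra_simps)
    then show ?case using abel_mean_diff[OF gT1 gh1 w(1), of \<rho>] elim by simp
  qed
  ultimately have "(abel_mean D w \<longlongrightarrow> 0) (at_left 1)" by (simp add: tendsto_cong)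
  moreover have "\<not> (abel_mean D w \<longlongrightarrow> 0) (at_left 1)"
  proof -
    \<comment> \<open>The approximant \<open>v\<close> repeats its value at e on the progression e +
      t N e. Two errors of \<gamma>/4 leave \<open>g\<close> at least \<gamma>/2 there.\<close>
    define \<gamma> where "\<gamma> = g e"
    have \<gamma>: "\<gamma> > 0" using g(4) e(2) by (simp add: \<gamma>_def)
    then have "\<gamma> / 4 > 0" by simp
    then obtain N v where v: "N > 0" "coprime N p" "\<And>n. v (n + N) = v n" "\<And>n. \<bar>g n - v n\<bar> \<le> \<gamma> / 4"
      using g(1) unfolding almost_periodic_coprime_def by metis
    \<comment> \<open>The gap between the cut-off value p^(-K) and the largest value p^(-K-1) that
      \<open>h\<close> can take at multiples of e.\<close>
    define \<delta> where "\<delta> = 1 / real p ^ K - 1 / real p ^ Suc K"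
    have \<delta>: "\<delta> > 0" using p1 by (simp add: \<delta>_def field_simps)
    show ?thesis
    proof (rule abel_mean_not_tendsto_0)
      show "0 \<le> D n" for n using g(2)[of n] hT[of n] by (simp add: D_def)
      show "D n \<le> 1" for n
        using g(2,3)[of n] hT[of n] T01[of n] h01[of n] unfolding D_def by (intro mult_le_one) auto
      show "norm w = 1" by fact
      show "w ^ n = 1" if "D n \<noteq> 0" for n
      proof -
        \<comment> \<open>\<open>D n\<close> is nonzero only where the cut-off acts strictly, that
          is, where a^n - b^n is divisible by one more power of p than p^K. By the choice of the
          level this forces p^(k+1) to divide n.\<close>
        have lt: "h n < 1 / real p ^ K" using that by (auto simp: D_def T_def max_def split: if_splits)
        then have 1: "int p ^ K dvd a ^ n - b ^ n" using pabs_le_iff[OF p] unfolding h_def by fastforce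
        have "int p ^ Suc K dvd a ^ n - b ^ n"
        proof (rule ccontr)
          assume 2: "\<not> int p ^ Suc K dvd a ^ n - b ^ n"
          then have "multiplicity (int p) (a ^ n - b ^ n) = K" using 1 by (intro multiplicity_eqI)
          moreover have "a ^ n - b ^ n \<noteq> 0" using 2 by (metis dvd_0_right)
          ultimately show False using lt by (simp add: h_def pabs_def)
        qed
        then have "p ^ Suc k dvd n" using e(1,3) by (meson dvd_trans)
        then show ?thesis using w(2) by blast
      qed
      show "\<gamma> / 2 * \<delta> > 0" "N * e > 0" using \<gamma> \<delta> v(1) e(2) by auto
      show "\<gamma> / 2 * \<delta> \<le> D (e + t * (N * e))" for t
      proof -
        have "v (e + t * (N * e)) = v e"
          using periodic_mult[of v N e "t * e"] v(3) by (simp add: mult_ac)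
        then have "\<gamma> / 2 \<le> g (e + t * (N * e))"
          using v(4)[of e] v(4)[of "e + t * (N * e)"] unfolding \<gamma>_def by linarith
        moreover have "h (e + t * (N * e)) \<le> 1 / real p ^ Suc K"
          unfolding h_def pabs_le_iff[OF p] e(3) by simp
        then have "\<delta> \<le> T (e + t * (N * e)) - h (e + t * (N * e))"
          by (simp add: \<delta>_def T_def)
        ultimately show ?thesis unfolding D_def using \<gamma> \<delta> by (intro mult_mono) auto
      qed
    qed
  qed
  ultimately show False by blast
qed

subsection \<open>Singularities on the circle of convergence\<close>

text \<open>The fractions j / p^(k+1) with j not divisible by p are dense in the reals, and each
  yields a root of unity of exact order p^(k+1).\<close>

lemma prime_power_roots_of_unity_dense:
  assumes p: "prime p" and z: "norm z = 1" and \<epsilon>: "\<epsilon> > 0"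
  obtains w :: complex and k where "norm w = 1" "dist w z < \<epsilon>" "\<And>n. w ^ n = 1 \<longleftrightarrow> p ^ Suc k dvd n"
proof -
  have p1: "real p > 1" using prime_gt_1_nat[OF p] by simp
  obtain \<theta> where \<theta>: "z = cis \<theta>"
    using z by (metis complex_norm_eq_1_exp cis_conv_exp mult.commute)
  have "isCont cis \<theta>" using continuous_on_cis[OF continuous_on_id, of UNIV]
    by (simp add: continuous_on_eq_continuous_at)
  then obtain \<delta> where \<delta>: "\<delta> > 0" "\<And>x. dist x \<theta> < \<delta> \<Longrightarrow> dist (cis x) (cis \<theta>) < \<epsilon>"
    using \<epsilon> unfolding continuous_at_eps_delta by (auto simp: dist_norm)
  define x where "x = \<theta> / (2 * pi)"
  obtain k where k: "(1 / real p) ^ k < \<delta> / (2 * pi)"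
    using real_arch_pow_inv[of "\<delta> / (2 * pi)" "1 / real p"] \<delta>(1) p1 by auto
  define q where "q = real p ^ Suc k"
  have q: "q > 0" "1 / q < \<delta> / (2 * pi)"
  proof -
    have "1 / q \<le> (1 / real p) ^ k" using p1 by (simp add: q_def power_one_over field_simps)
    then show "1 / q < \<delta> / (2 * pi)" using k by linarith
  qed (use p1 in \<open>simp add: q_def\<close>)
  \<comment> \<open>Of two consecutive integers at least one is prime to p; the floor of x q and its
    successor are both within 1 of x q.\<close>
  obtain j :: int where j: "\<not> int p dvd j" "\<bar>real_of_int j - x * q\<bar> \<le> 1"
  proof (cases "int p dvd \<lfloor>x * q\<rfloor>")
    case True
    then have "\<not> int p dvd \<lfloor>x * q\<rfloor> + 1"
      using prime_gt_1_nat[OF p] by (auto simp: dvd_add_right_iff)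
    then show ?thesis by (rule that) linarith
  next
    case False
    then show ?thesis by (rule that) linarith
  qed
  define w where "w = cis (2 * pi * (real_of_int j / q))"
  have "\<bar>real_of_int j / q - x\<bar> = \<bar>real_of_int j - x * q\<bar> / q"
    using q(1) by (simp add: field_simps abs_if)
  also have "\<dots> \<le> 1 / q" using j(2) q(1) by (intro divide_right_mono) auto
  finally have "2 * pi * \<bar>real_of_int j / q - x\<bar> < 2 * pi * (\<delta> / (2 * pi))"
    using q(2) by (intro mult_strict_left_mono) auto
  moreover have "2 * pi * (real_of_int j / q) - \<theta> = 2 * pi * (real_of_int j / q - x)"
    by (simp add: x_def right_diff_distrib)
  ultimately have "dist (2 * pi * (real_of_int j / q)) \<theta> < \<delta>"
    by (simp add: dist_real_def abs_mult)
  then have "dist w z < \<epsilon>" unfolding w_def \<theta> by (rule \<delta>(2))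
  moreover have "w ^ n = 1 \<longleftrightarrow> p ^ Suc k dvd n" for n
  proof -
    have "w ^ n = 1 \<longleftrightarrow> (\<exists>m. real n * (2 * pi * (real_of_int j / q)) = of_int m * (2 * pi))"
      by (simp only: w_def Complex.DeMoivre cis_eq_1_iff)
    also have "\<dots> \<longleftrightarrow> (\<exists>m. real n * real_of_int j = of_int m * q)"
      using q(1) by (simp add: field_simps)
    also have "\<dots> \<longleftrightarrow> (\<exists>m. int n * j = m * int (p ^ Suc k))"
      unfolding q_def by (metis (mono_tags, opaque_lifting) of_int_eq_iff of_int_mult of_int_of_nat_eq of_nat_power)
    also have "\<dots> \<longleftrightarrow> int (p ^ Suc k) dvd int n * j"
      by (auto simp: dvd_def mult.commute)
    also have "\<dots> \<longleftrightarrow> int (p ^ Suc k) dvd int n"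
    proof (rule coprime_dvd_mult_left_iff)
      have "coprime (int p) j" using p j(1) by (intro prime_imp_coprime) auto
      then show "coprime (int (p ^ Suc k)) j" by (simp del: power_Suc)
    qed
    also have "\<dots> \<longleftrightarrow> p ^ Suc k dvd n" by (rule of_nat_dvd_iff)
    finally show ?thesis .
  qed
  ultimately show ?thesis using that[of w k] by (simp add: w_def)
qed

text \<open>A function continuous at w/A is bounded near it, so 1 - \<rho> times its value at \<rho>
  w/A tends to 0. That product is the mean of c(n) - \<sigma>^n c(n), whose second term is summable
  and has mean 0. As \<open>g\<close> is tied to \<open>F\<close> only inside the disc of radius
  1/A, the lemma applies to the sum of the series as well as to a continuation.\<close>

lemma geometric_coefficients_singular:
  assumes A: "A > 0" and \<sigma>: "\<bar>\<sigma>\<bar> < 1" and c: "\<And>n. \<bar>c n\<bar> \<le> 1" 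
    and f: "\<And>n. fps_nth F n = of_real (A ^ n * (1 - \<sigma> ^ n) * c n)"
    and w: "norm w = 1" "\<not> (abel_mean c w \<longlongrightarrow> 0) (at_left 1)"
    and g: "\<And>z. norm z < 1 / A \<Longrightarrow> g z = eval_fps F z"
  shows "\<not> isCont g (w / of_real A)"
proof
  assume cont: "isCont g (w / of_real A)"
  define c' where "c' n = \<sigma> ^ n * c n" for n
  have c': "\<bar>c' n\<bar> \<le> \<bar>\<sigma>\<bar> ^ n" for n
    using c[of n] by (simp add: c'_def abs_mult power_abs mult_left_le)
  have c'1: "\<bar>c' n\<bar> \<le> 1" for n
    using c'[of n] \<sigma> by (meson abs_ge_zero less_imp_le order_trans power_le_one)
  have "summable (\<lambda>n. \<bar>c' n\<bar>)"
    using \<sigma> c' by (intro summable_comparison_test'[OF summable_geometric[of "\<bar>\<sigma>\<bar>"]]) auto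
  then have 1: "(abel_mean c' w \<longlongrightarrow> 0) (at_left 1)" by (rule abel_mean_summable_tendsto_0[OF _ w(1)])
  have lim: "((\<lambda>\<rho>. of_real \<rho> * w / of_real A) \<longlongrightarrow> of_real 1 * w / of_real A) (at_left 1)"
    using A by (intro tendsto_intros) auto
  have "((\<lambda>\<rho>. of_real (1 - \<rho>) * g (of_real \<rho> * w / of_real A))
      \<longlongrightarrow> of_real (1 - 1) * g (w / of_real A)) (at_left 1)"
    using isCont_tendsto_compose[OF cont, of "\<lambda>\<rho>. of_real \<rho> * w / of_real A"] lim
    by (intro tendsto_intros) simp
  with 1 have "((\<lambda>\<rho>. of_real (1 - \<rho>) * g (of_real \<rho> * w / of_real A) + abel_mean c' w \<rho>) \<longlongrightarrow> 0 + 0) (at_left 1)"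
    by (intro tendsto_add) simp_all
  moreover have "\<forall>\<^sub>F \<rho> in at_left 1. of_real (1 - \<rho>) * g (of_real \<rho> * w / of_real A) + abel_mean c' w \<rho> = abel_mean c w \<rho>"
    using eventually_at_left_1
  proof eventually_elim
    case (elim \<rho>)
    have "norm (of_real \<rho> * w / of_real A) < 1 / A"
      using elim A w by (simp add: norm_mult norm_divide divide_strict_right_mono)
    then have "g (of_real \<rho> * w / of_real A) = (\<Sum>n. fps_nth F n * (of_real \<rho> * w / of_real A) ^ n)"
      by (simp add: g eval_fps_def)
    also have "\<dots> = (\<Sum>n. of_real (c n - c' n) * (of_real \<rho> * w) ^ n)"
      using A by (intro suminf_cong) (simp add: f c'_def power_divide algebra_simps)
    finally have "of_real (1 - \<rho>) * g (of_real \<rho> * w / of_real A) = abel_mean (\<lambda>n. c n - c' n) w \<rho>"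
      by (simp add: abel_mean_def)
    then show ?case using abel_mean_diff[OF c c'1 w(1), of \<rho>] elim by simp
  qed
  ultimately have "(abel_mean c w \<longlongrightarrow> 0) (at_left 1)" by (simp add: tendsto_cong)
  with w(2) show False ..
qed

lemma has_natural_boundaryI:
  assumes A: "A > 0" and \<sigma>: "\<bar>\<sigma>\<bar> < 1" and c: "\<And>n. \<bar>c n\<bar> \<le> 1" 
    and f: "\<And>n. fps_nth F n = of_real (A ^ n * (1 - \<sigma> ^ n) * c n)"
    and dense: "\<And>z \<epsilon>. norm z = 1 \<Longrightarrow> \<epsilon> > 0 \<Longrightarrow>
      \<exists>w. norm w = 1 \<and> dist w z < \<epsilon> \<and> \<not> (abel_mean c w \<longlongrightarrow> 0) (at_left 1)"
  shows "has_natural_boundary F"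
proof -
  have "fps_conv_radius F \<ge> ereal (1 / A)"
    unfolding fps_conv_radius_def
  proof (rule conv_radius_geI_ex')
    fix t assume t: "0 < t" "ereal t < ereal (1 / A)"
    then have "A * t < 1" using A by (simp add: field_simps)
    \<comment> \<open>The factor 1 - \<sigma>^n can be as large as 2; halving gives the bound 1, and
      the factor 2 is restored afterwards.\<close>
    have "\<bar>(1 - \<sigma> ^ n) * c n / 2\<bar> \<le> 1" for n
    proof -
      have "\<bar>\<sigma> ^ n\<bar> \<le> 1" using \<sigma> by (simp add: power_abs power_le_one)
      then have "\<bar>1 - \<sigma> ^ n\<bar> * \<bar>c n\<bar> \<le> 2 * 1" using c[of n] by (intro mult_mono) auto
      then show ?thesis by (simp add: abs_mult)
    qed
    then have "summable (\<lambda>n. of_real ((1 - \<sigma> ^ n) * c n / 2) * (of_real (A * t) * 1) ^ n :: complex)"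
      using \<open>A * t < 1\<close> A t by (intro summable_bounded[where B = 1]) auto
    from summable_mult[OF this, of 2] show "summable (\<lambda>n. fps_nth F n * of_real t ^ n)"
      by (simp add: f power_mult_distrib mult_ac)
  qed
  \<comment> \<open>No growth estimate from below is made: with a larger radius the sum of the
    series would itself be continuous at a singular point w/A.\<close>
  moreover have "fps_conv_radius F \<le> ereal (1 / A)"
  proof (rule ccontr)
    assume "\<not> fps_conv_radius F \<le> ereal (1 / A)"
    then have lt: "ereal (1 / A) < fps_conv_radius F" by simp
    obtain w where w: "norm w = 1" "\<not> (abel_mean c w \<longlongrightarrow> 0) (at_left 1)"
      using dense[of 1 1] by auto
    have "isCont (eval_fps F) (w / of_real A)"
      using lt A w by (intro continuous_eval_fps) (simp add: norm_divide)
    with geometric_coefficients_singular[OF A \<sigma> c f w, of "eval_fps F"] show False by simp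
  qed
  ultimately have R: "fps_conv_radius F = ereal (1 / A)" by (rule antisym[rotated])
  have disc: "conv_disc F = ball 0 (1 / A)" by (simp add: conv_disc_def R)
  have False if U: "open U" "connected U" "conv_disc F \<subset> U" and g: "g holomorphic_on U"
    "\<forall>z\<in>conv_disc F. g z = eval_fps F z" for U g
  proof -
    \<comment> \<open>Otherwise the open disc and the exterior of the closed disc would separate the
      connected set \<open>U\<close>, which contains the disc properly.\<close>
    have "U \<inter> sphere 0 (1 / A) \<noteq> {}"
    proof
      assume "U \<inter> sphere 0 (1 / A) = {}"
      then have "U \<subseteq> ball 0 (1 / A) \<union> - cball 0 (1 / A)" by force
      moreover have "ball 0 (1 / A) \<inter> - cball 0 (1 / A) \<inter> U = {}" by auto
      ultimately have "ball 0 (1 / A) \<inter> U = {} \<or> - cball 0 (1 / A) \<inter> U = {}"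
        using U(2) by (intro connectedD) auto
      moreover have "0 \<in> ball 0 (1 / A) \<inter> U" using A U(3) unfolding disc by force
      ultimately have "U \<subseteq> ball 0 (1 / A)" using \<open>U \<subseteq> _\<close> by blast
      then show False using U(3) by (auto simp: disc)
    qed
    then obtain y where y: "y \<in> U" "norm y = 1 / A" by auto
    obtain \<epsilon> where \<epsilon>: "\<epsilon> > 0" "ball y \<epsilon> \<subseteq> U" using U(1) y(1) openE by blast
    obtain w where w: "norm w = 1" "dist w (of_real A * y) < A * \<epsilon>" "\<not> (abel_mean c w \<longlongrightarrow> 0) (at_left 1)"
      using dense[of "of_real A * y" "A * \<epsilon>"] A y \<epsilon> by (auto simp: norm_mult)
    have "dist (w / of_real A) y = norm ((w - of_real A * y) / of_real A)"
      using A by (simp add: dist_norm diff_divide_distrib)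
    also have "\<dots> = dist w (of_real A * y) / A" using A by (simp add: norm_divide dist_norm)
    also have "\<dots> < \<epsilon>" using w(2) A by (simp add: field_simps)
    finally have "w / of_real A \<in> U" using \<epsilon> by (auto simp: dist_commute)
    then have "isCont g (w / of_real A)"
      using g(1) U(1) by (meson continuous_on_eq_continuous_at holomorphic_on_imp_continuous_on)
    with geometric_coefficients_singular[OF A \<sigma> c f w(1,3), of g] g(2) show False by (simp add: disc)
  qed
  then have "\<not> (\<exists>U g. open U \<and> connected U \<and> conv_disc F \<subset> U \<and> g holomorphic_on U \<and>
      (\<forall>z\<in>conv_disc F. g z = eval_fps F z))"
    by blast
  then show ?thesis unfolding has_natural_boundary_def using A by (simp add: R)
qed

text \<open>The series is a difference of two geometric series, with ratios A z and A \<sigma>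
  z.\<close>

lemma rational_function_on_geometric:
  assumes A: "A > 0" and \<sigma>: "\<bar>\<sigma>\<bar> < 1" and f: "\<And>n. fps_nth F n = of_real (A ^ n * (1 - \<sigma> ^ n))"
  shows "rational_function_on (eval_fps F) (conv_disc F)"
proof -
  define \<alpha> \<beta> :: complex where "\<alpha> = of_real A" and "\<beta> = of_real (A * \<sigma>)"
  have "poly ([:1, -\<alpha>:] * [:1, -\<beta>:]) z \<noteq> 0 \<and>
      eval_fps F z = poly ([:1, -\<beta>:] - [:1, -\<alpha>:]) z / poly ([:1, -\<alpha>:] * [:1, -\<beta>:]) z"
    if z: "z \<in> conv_disc F" for z
  proof -
    have "summable (\<lambda>n. fps_nth F n * z ^ n)" using z by (intro summable_fps) (simp add: conv_disc_def)
    then have lim: "(\<lambda>n. norm (fps_nth F n * z ^ n)) \<longlonglongrightarrow> 0"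
      by (intro tendsto_norm_zero summable_LIMSEQ_zero)
    \<comment> \<open>The radius of convergence is not known here. The terms tend to 0, while for A
      |z| at least 1 and n at least 1 they have norm at least 1 - |\<sigma>|.\<close>
    have Az: "A * norm z < 1"
    proof (rule ccontr)
      assume "\<not> A * norm z < 1"
      have "1 - \<bar>\<sigma>\<bar> \<le> norm (fps_nth F n * z ^ n)" if "n \<ge> 1" for n
      proof -
        have "\<bar>\<sigma> ^ n\<bar> \<le> \<bar>\<sigma>\<bar>" using power_decreasing[OF that, of "\<bar>\<sigma>\<bar>"] \<sigma> by (simp add: power_abs)
        then have "(1 - \<bar>\<sigma>\<bar>) * 1 \<le> \<bar>1 - \<sigma> ^ n\<bar> * (A * norm z) ^ n"
          using \<open>\<not> A * norm z < 1\<close> \<sigma> by (intro mult_mono one_le_power) auto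
        also have "\<dots> = norm (fps_nth F n * z ^ n)"
          using A by (simp only: f norm_mult norm_of_real norm_power abs_mult) 
            (simp add: power_mult_distrib)
        finally show ?thesis by simp
      qed
      then have "1 - \<bar>\<sigma>\<bar> \<le> 0" using LIMSEQ_le_const[OF lim] by blast
      with \<sigma> show False by simp
    qed
    then have \<alpha>: "norm (\<alpha> * z) < 1" using A by (simp add: \<alpha>_def norm_mult)
    have "norm (\<beta> * z) = \<bar>\<sigma>\<bar> * (A * norm z)" using A by (simp add: \<beta>_def norm_mult abs_mult)
    also have "\<dots> \<le> 1 * (A * norm z)" using A \<sigma> by (intro mult_right_mono) auto
    finally have \<beta>: "norm (\<beta> * z) < 1" using Az by simp
    have ne: "1 - \<alpha> * z \<noteq> 0" "1 - \<beta> * z \<noteq> 0" using \<alpha> \<beta> by auto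
    have "(\<lambda>n. (\<alpha> * z) ^ n - (\<beta> * z) ^ n) sums (1 / (1 - \<alpha> * z) - 1 / (1 - \<beta> * z))"
      by (intro sums_diff geometric_sums \<alpha> \<beta>)
    also have "(\<lambda>n. (\<alpha> * z) ^ n - (\<beta> * z) ^ n) = (\<lambda>n. fps_nth F n * z ^ n)"
      by (simp add: f \<alpha>_def \<beta>_def power_mult_distrib algebra_simps)
    finally have "eval_fps F z = 1 / (1 - \<alpha> * z) - 1 / (1 - \<beta> * z)"
      by (simp add: eval_fps_def sums_iff)
    also have "\<dots> = ((1 - \<beta> * z) - (1 - \<alpha> * z)) / ((1 - \<alpha> * z) * (1 - \<beta> * z))"
      using ne by (simp add: diff_frac_eq)
    finally have "eval_fps F z = ((1 - \<beta> * z) - (1 - \<alpha> * z)) / ((1 - \<alpha> * z) * (1 - \<beta> * z))" .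
    moreover have "poly [:1, -\<alpha>:] z = 1 - \<alpha> * z" "poly [:1, -\<beta>:] z = 1 - \<beta> * z"
      by (simp_all add: mult.commute)
    ultimately show ?thesis using ne by (simp only: poly_mult poly_diff mult_eq_0_iff not_False_eq_True simp_thms)
  qed
  then show ?thesis unfolding rational_function_on_def by blast
qed

subsection \<open>The coefficients\<close>

text \<open>The product formula for m: \<open>S\<close> contains all its prime factors, and the
  other primes of \<open>S\<close> contribute 1.\<close>

lemma prod_prime_power_multiplicity:
  fixes m :: int
  assumes "m > 0" "finite S" "\<And>p. p \<in> S \<Longrightarrow> prime p" "\<And>p. prime p \<Longrightarrow> int p dvd m \<Longrightarrow> p \<in> S"
  shows "(\<Prod>p\<in>S. real p ^ multiplicity (int p) m) = real_of_int m"
proof -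
  have "m = (\<Prod>q\<in>prime_factors m. q ^ multiplicity q m)"
    using assms(1) by (simp add: prod_prime_factors)
  also have "\<dots> = (\<Prod>q\<in>int ` S. q ^ multiplicity q m)"
  proof (rule prod.mono_neutral_left)
    show "prime_factors m \<subseteq> int ` S"
    proof
      fix q assume "q \<in> prime_factors m"
      then have q: "prime q" "q dvd m" by (auto simp: in_prime_factors_iff)
      then obtain k where "q = int k" "prime k" by (metis prime_int_iff prime_nat_int_transfer zero_le_imp_eq_int prime_ge_0_int)
      with q assms(4) show "q \<in> int ` S" by auto
    qed
    show "\<forall>i\<in>int ` S - prime_factors m. i ^ multiplicity i m = 1"
      using assms(1,3) by (auto simp: in_prime_factors_iff not_dvd_imp_multiplicity_0)
  qed (use assms in auto)
  also have "\<dots> = (\<Prod>p\<in>S. int p ^ multiplicity (int p) m)"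
    by (simp add: prod.reindex)
  finally have "real_of_int m = real_of_int (\<Prod>p\<in>S. int p ^ multiplicity (int p) m)" by simp
  then show ?thesis by simp
qed

lemma padic_abs_divide:
  assumes p: "prime p" and xy: "coprime x y" "y > 0" "x \<noteq> 0"
  shows "padic_abs p (of_int x / of_int y) = real p ^ multiplicity (int p) y * pabs p x"
proof -
  have "quotient_of (of_int x / of_int y) = (x, y)"
    using xy by (simp add: quotient_of_Fract flip: Fract_of_int_quotient)
  moreover have "real p \<noteq> 0" using prime_gt_0_nat[OF p] by simp
  ultimately show ?thesis
    using xy by (simp add: padic_abs_def pabs_def power_int_diff)
qed

text \<open>The fraction r^n - 1 = (a^n - b^n) / b^n is in lowest terms. All primes of b lie in
  \<open>S\<close>, so the denominator contributes b^n to the S-adic part, and this cancels its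
  contribution to the real absolute value.\<close>

lemma f_coeff_eq:
  fixes a b :: int
  assumes S: "finite S" "\<And>p. p \<in> S \<Longrightarrow> prime p" "\<And>p. prime p \<Longrightarrow> int p dvd b \<Longrightarrow> p \<in> S"
    and ab: "coprime a b" "b > 0" and neq: "a ^ n \<noteq> b ^ n"
  shows "f_coeff (of_int a / of_int b) S n = \<bar>of_int (a ^ n - b ^ n)\<bar> * (\<Prod>p\<in>S. pabs p (a ^ n - b ^ n))"
proof -
  define x y where "x = a ^ n - b ^ n" and "y = b ^ n"
  have n: "n > 0" using neq by (cases n) auto
  have "gcd (a ^ n - b ^ n) (b ^ n) = gcd (a ^ n) (b ^ n)"
    by (metis gcd_add1 diff_add_cancel)
  moreover have "coprime (a ^ n) (b ^ n)" using ab by simp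
  ultimately have "coprime x y" by (simp only: x_def y_def coprime_iff_gcd_eq_1)
  then have xy: "coprime x y" "y > 0" "x \<noteq> 0"
    using ab neq by (simp_all add: x_def y_def)
  have eq: "(of_int a / of_int b :: rat) ^ n - 1 = of_int x / of_int y"
    using ab by (simp add: x_def y_def power_divide field_simps)
  have yS: "p \<in> S" if "prime p" "int p dvd y" for p
    using that S(3) prime_dvd_power[of "int p"] by (auto simp: y_def)
  have "(\<Prod>p\<in>S. real p ^ multiplicity (int p) y) = real_of_int y"
    by (rule prod_prime_power_multiplicity[OF xy(2) S(1)]) (fact S(2), fact yS)
  then have "S_abs S (of_int x / of_int y) = of_int y * (\<Prod>p\<in>S. pabs p x)"
    using S(2) xy by (simp add: S_abs_def padic_abs_divide prod.distrib)
  moreover have "\<bar>of_rat (of_int x / of_int y) :: real\<bar> * of_int y = \<bar>of_int x\<bar>"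
    using xy by (simp add: of_rat_divide abs_divide)
  ultimately show ?thesis unfolding f_coeff_def eq by (simp add: x_def y_def mult_ac)
qed

text \<open>A is the larger absolute value and \<sigma> the signed ratio of the smaller number to
  the larger. As |\<sigma>^n| is at most 1, the second factor is nonnegative for either sign of
  \<sigma>.\<close>

lemma abs_power_diff_eq:
  fixes x y :: real
  assumes "x \<noteq> 0" "y \<noteq> 0" "\<bar>x\<bar> \<noteq> \<bar>y\<bar>"
  obtains A \<sigma> where "A > 0" "\<bar>\<sigma>\<bar> < 1" "\<And>n. \<bar>x ^ n - y ^ n\<bar> = A ^ n * (1 - \<sigma> ^ n)"
proof -
  have key: "\<bar>x ^ n - y ^ n\<bar> = \<bar>x\<bar> ^ n * (1 - (y / x) ^ n)" "\<bar>y / x\<bar> < 1"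
    if "x \<noteq> 0" "\<bar>y\<bar> < \<bar>x\<bar>" for x y :: real and n
  proof -
    show lt: "\<bar>y / x\<bar> < 1" using that by (simp add: abs_divide)
    then have "\<bar>(y / x) ^ n\<bar> \<le> 1" by (simp only: power_abs) (simp add: power_le_one)
    then have "1 - (y / x) ^ n = \<bar>1 - (y / x) ^ n\<bar>" by simp
    moreover have "x ^ n - y ^ n = x ^ n * (1 - (y / x) ^ n)" 
      using that by (simp add: power_divide field_simps)
    ultimately show "\<bar>x ^ n - y ^ n\<bar> = \<bar>x\<bar> ^ n * (1 - (y / x) ^ n)"
      by (metis abs_mult power_abs)
  qed
  show ?thesis
  proof (cases "\<bar>y\<bar> < \<bar>x\<bar>")
    case True
    show ?thesis using that[of "\<bar>x\<bar>" "y / x"] key[OF assms(1) True] assms by simp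
  next
    case False
    then have "\<bar>x\<bar> < \<bar>y\<bar>" using assms by simp
    then show ?thesis
      using that[of "\<bar>y\<bar>" "x / y"] key[OF assms(2)] assms by (simp add: abs_minus_commute)
  qed
qed

theorem corollary10:
  fixes r :: rat and S :: "nat set"
  assumes "r \<notin> {0, 1, -1}"
    and "\<And>p. p \<in> S \<Longrightarrow> prime p"
    and "\<And>p. prime p \<Longrightarrow> p \<notin> S \<Longrightarrow> padic_abs p r = 1"
    and "finite S"
    and "\<not> rational_function_on (eval_fps (F_series r S)) (conv_disc (F_series r S))"
  shows "has_natural_boundary (F_series r S)"
proof -
  obtain a b where ab: "quotient_of r = (a, b)" by fastforce
  have b0: "b > 0" and cop: "coprime a b" and r: "r = of_int a / of_int b"
    using quotient_of_denom_pos[OF ab] quotient_of_coprime[OF ab] quotient_of_div[OF ab] by auto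
  have a0: "a \<noteq> 0" using assms(1) r by auto
  have ne: "\<bar>a\<bar> \<noteq> \<bar>b\<bar>"
  proof
    assume "\<bar>a\<bar> = \<bar>b\<bar>"
    then have "a = b \<or> a = - b" by linarith
    then show False using assms(1) r b0 by auto
  qed
  have neq: "a ^ n \<noteq> b ^ n" if "n > 0" for n
  proof
    assume "a ^ n = b ^ n"
    then have "\<bar>a\<bar> ^ n = \<bar>b\<bar> ^ n" by (metis power_abs)
    then show False using ne that power_eq_imp_eq_base[of "\<bar>a\<bar>" n "\<bar>b\<bar>"] by auto
  qed
  \<comment> \<open>A prime p dividing b does not divide a, so |r|_p > 1; outside \<open>S\<close>
    this is excluded.\<close>
  have bS: "p \<in> S" if p: "prime p" "int p dvd b" for p
  proof (rule ccontr)
    assume "p \<notin> S"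
    have p1: "p > 1" by (rule prime_gt_1_nat[OF p(1)])
    have "\<not> int p dvd a"
      using cop p p1 by (metis coprime_common_divisor_int int_one_le_iff_zero_less less_irrefl not_coprimeI prime_nat_int_transfer not_prime_unit)
    then have "pabs p a = 1" using a0 by (simp add: pabs_def not_dvd_imp_multiplicity_0)
    then have "real p ^ multiplicity (int p) b = 1"
      using assms(3)[OF p(1) \<open>p \<notin> S\<close>] padic_abs_divide[OF p(1) cop b0 a0] r by simp
    then have "multiplicity (int p) b = 0" using p1 power_inject_exp[of "real p" "multiplicity (int p) b" 0] by simp
    then show False using p b0 p1 by (simp add: multiplicity_eq_zero_iff)
  qed
  obtain A \<sigma> where A: "A > 0" and \<sigma>: "\<bar>\<sigma>\<bar> < 1"
    and diff: "\<And>n. \<bar>of_int a ^ n - of_int b ^ n :: real\<bar> = A ^ n * (1 - \<sigma> ^ n)"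
    using abs_power_diff_eq[of "of_int a" "of_int b"] a0 b0 ne
    by (metis of_int_0_eq_iff of_int_abs of_int_eq_iff less_irrefl)
  define S' where "S' = {p \<in> S. coprime a (int p) \<and> coprime b (int p)}"
  define c where "c n = (\<Prod>p\<in>S'. pabs p (a ^ n - b ^ n))" for n
  have S': "finite S'" "S' \<subseteq> S" using assms(4) by (auto simp: S'_def)
  \<comment> \<open>A prime dividing exactly one of a and b does not divide a^n - b^n. This needs n
    > 0: at n = 0 the difference is 0 and every \<open>pabs\<close> vanishes.\<close>
  have c_eq: "(\<Prod>p\<in>S. pabs p (a ^ n - b ^ n)) = c n" if n: "n > 0" for n
    unfolding c_def
  proof (rule prod.mono_neutral_right)
    show "\<forall>p\<in>S - S'. pabs p (a ^ n - b ^ n) = 1"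
    proof
      fix p assume p: "p \<in> S - S'"
      then have pr: "prime (int p)" using assms(2) by simp
      have "int p dvd a \<or> int p dvd b"
        using p pr prime_imp_coprime[of "int p"] by (auto simp: S'_def coprime_commute)
      moreover have "\<not> (int p dvd a \<and> int p dvd b)"
        using cop pr by (meson coprime_common_divisor not_prime_unit)
      ultimately have "int p dvd a ^ n \<longleftrightarrow> \<not> int p dvd b ^ n"
        using prime_dvd_power_iff[OF pr n] by blast
      then have "\<not> int p dvd a ^ n - b ^ n"
        using dvd_diff_left_iff dvd_diff_right_iff by blast
      then show "pabs p (a ^ n - b ^ n) = 1"
        using neq[OF n] by (simp add: pabs_def not_dvd_imp_multiplicity_0)
    qed
  qed (use assms(4) S' in auto)
  \<comment> \<open>At n = 0 both sides are 0: \<open>F_series\<close> starts at n = 1, and 1 -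
    \<sigma>^0 = 0 whatever \<open>c 0\<close> is.\<close>
  have F: "fps_nth (F_series r S) n = of_real (A ^ n * (1 - \<sigma> ^ n) * c n)" for n
  proof (cases "n = 0")
    case False
    then show ?thesis
      using f_coeff_eq[OF assms(4,2) bS cop b0 neq] diff[of n] by (simp add: F_series_def r c_eq)
  qed (simp add: F_series_def)
  have "S' \<noteq> {}"
  proof
    assume "S' = {}"
    then have "rational_function_on (eval_fps (F_series r S)) (conv_disc (F_series r S))"
      using F by (intro rational_function_on_geometric[OF A \<sigma>]) (simp add: c_def)
    with assms(5) show False ..
  qed
  define p where "p = Max S'"
  have pS: "p \<in> S'" and pmax: "\<And>q. q \<in> S' - {p} \<Longrightarrow> q < p"
    using S' \<open>S' \<noteq> {}\<close> by (auto simp: p_def less_le)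
  have p: "prime p" using pS S' assms(2) by auto
  have pr: "prime q" "coprime a (int q)" "coprime b (int q)" if "q \<in> S'" for q
    using that assms(2) by (auto simp: S'_def)
  define g where "g n = (\<Prod>q\<in>S' - {p}. pabs q (a ^ n - b ^ n))" for n
  have cg: "c = (\<lambda>n. g n * pabs p (a ^ n - b ^ n))"
    using S' pS by (auto simp: c_def g_def prod.remove[of S' p] mult.commute)
  have g01: "0 \<le> g n" "g n \<le> 1" for n
    unfolding g_def by (auto intro!: prod_nonneg prod_le_1 pabs_nonneg pabs_le_1 pr)
  have gpos: "0 < g n" if "n > 0" for n
    unfolding g_def using neq[OF that] by (auto intro!: prod_pos pabs_pos pr)
  have gap: "almost_periodic_coprime p g"
    unfolding g_def using S'
    by (intro almost_periodic_coprime_prod almost_periodic_pabs_power_diff p pr pmax)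
       (auto simp: pabs_nonneg intro!: pabs_le_1 pr)
  have c1: "\<bar>c n\<bar> \<le> 1" for n
    unfolding cg using g01[of n] pabs_nonneg[of p] pabs_le_1[OF p] by (auto simp: abs_mult intro!: mult_le_one)
  show ?thesis
  proof (rule has_natural_boundaryI[OF A \<sigma> c1 F])
    fix z :: complex and \<epsilon> :: real assume z: "norm z = 1" "\<epsilon> > 0"
    obtain w k where w: "norm w = 1" "dist w z < \<epsilon>" "\<And>n. w ^ n = 1 \<longleftrightarrow> p ^ Suc k dvd n"
      using prime_power_roots_of_unity_dense[OF p z] by metis
    have "\<not> (abel_mean c w \<longlongrightarrow> 0) (at_left 1)"
      unfolding cg by (rule abel_mean_pabs_not_tendsto_0[OF p pr(2,3)[OF pS] neq w(1,3) gap g01 gpos])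
    with w show "\<exists>w. norm w = 1 \<and> dist w z < \<epsilon> \<and> \<not> (abel_mean c w \<longlongrightarrow> 0) (at_left 1)" by blast
  qed
qed

end
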